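(* Let $0<q<1$, $\alpha\ge0$ and $\varphi\in C[0,1]$. Then $$\lim_{n\to\infty}S_n^{q,\alpha}(\varphi;x)=S_\infty^{q,\alpha}(\varphi;x),$$ and the convergence is uniform for $x\in[0,1]$.
   Context: For $i\in\mathbb{N}_0$, $[i]_q=1+q+\cdots+q^{i-1}$, $[0]_q=0$; $[i]_q!=[1]_q\cdots[i]_q$, $[0]_q!=1$; and for $0\le k\le n$, $\begin{bmatrix} n\\k\end{bmatrix}_q=\frac{[n]_q!}{[k]_q!\,[n-k]_q!}$. The $q$-Pochhammer symbols are $(a;q)_0=1$, $(a;q)_m=\prod_{j=0}^{m-1}(1-aq^j)$, $(a;q)_\infty=\prod_{j=0}^\infty(1-aq^j)$. Empty products equal $1$. Put $\gamma=\alpha/(1-q)$. For $n\in\mathbb{N}$, $f\in C[0,1]$ and $x\in[0,1]$, the $q$-Stancu operator is $$S_n^{q,\alpha}(f;x)=\sum_{k=0}^{n}f\left(\frac{[k]_q}{[n]_q}\right)p_{n,k}^{q,\alpha}(x),\qquad p_{n,k}^{q,\alpha}(x)=\begin{bmatrix} n\\k\end{bmatrix}_q\frac{\prod_{i=0}^{k-1}(x+\alpha[i]_q)\prod_{s=0}^{n-1-k}(1-q^sx+\alpha[s]_q)}{\prod_{i=0}^{n-1}(1+\alpha[i]_q)}.$$ For $k\in\mathbb{N}_0$ and $x\in[0,1]$ let $$p_{\infty k}^{q,\alpha}(x)=\frac{\left(\frac{\gamma}{x+\gamma};q\right)_k\left(\frac{x+\gamma}{1+\gamma};q\right)_\infty\left(\frac{x+\gamma}{1+\gamma}\right)^k}{(q;q)_k\left(\frac{\gamma}{1+\gamma};q\right)_\infty},$$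 where the product $\left(\frac{\gamma}{x+\gamma};q\right)_k\left(\frac{x+\gamma}{1+\gamma}\right)^k$ is read as $(1+\gamma)^{-k}\prod_{i=0}^{k-1}(x+\gamma-\gamma q^i)$ (relevant only when $x=\gamma=0$). The limit $q$-Stancu operator is $$S_\infty^{q,\alpha}(f;x)=\sum_{k=0}^\infty f(1-q^k)\,p_{\infty k}^{q,\alpha}(x)\ \text{ for } x\in[0,1),\qquad S_\infty^{q,\alpha}(f;1)=f(1).$$ *)

theory Defs
  imports "HOL-Analysis.Analysis"
begin

definition q_int :: "real \<Rightarrow> nat \<Rightarrow> real" where
  "q_int q i = (\<Sum>j<i. q ^ j)"

definition q_fact :: "real \<Rightarrow> nat \<Rightarrow> real" where
  "q_fact q n = (\<Prod>i=1..n. q_int q i)"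

text \<open>Only meant for \<open>k \<le> n\<close>, since \<open>n - k\<close> is truncated.\<close>
definition q_binomial :: "real \<Rightarrow> nat \<Rightarrow> nat \<Rightarrow> real" where
  "q_binomial q n k = q_fact q n / (q_fact q k * q_fact q (n - k))"

definition q_pochhammer :: "real \<Rightarrow> real \<Rightarrow> nat \<Rightarrow> real" where
  "q_pochhammer a q m = (\<Prod>j<m. 1 - a * q ^ j)"

definition q_pochhammer_inf :: "real \<Rightarrow> real \<Rightarrow> real" where
  "q_pochhammer_inf a q = (\<Prod>j. 1 - a * q ^ j)"

definition q_stancu_basis :: "real \<Rightarrow> real \<Rightarrow> nat \<Rightarrow> nat \<Rightarrow> real \<Rightarrow> real" where
  "q_stancu_basis q \<alpha> n k x =
     q_binomial q n k *
     ((\<Prod>i<k. x + \<alpha> * q_int q i) * (\<Prod>s<n - k. 1 - q ^ s * x + \<alpha> * q_int q s)) /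
     (\<Prod>i<n. 1 + \<alpha> * q_int q i)"

definition q_stancu :: "real \<Rightarrow> real \<Rightarrow> nat \<Rightarrow> (real \<Rightarrow> real) \<Rightarrow> real \<Rightarrow> real" where
  "q_stancu q \<alpha> n f x = (\<Sum>k\<le>n. f (q_int q k / q_int q n) * q_stancu_basis q \<alpha> n k x)"

definition stancu_gamma :: "real \<Rightarrow> real \<Rightarrow> real" where
  "stancu_gamma q \<alpha> = \<alpha> / (1 - q)"

text \<open>For \<open>x = \<gamma> = 0\<close> the quotient \<open>\<gamma> / (x + \<gamma>)\<close> is \<open>0\<close> by the convention on division by zero.
  The lemma below shows that the formula then has the intended value.\<close>
definition limit_q_stancu_basis :: "real \<Rightarrow> real \<Rightarrow> nat \<Rightarrow> real \<Rightarrow> real" where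
  "limit_q_stancu_basis q \<alpha> k x =
     (let \<gamma> = stancu_gamma q \<alpha> in
       q_pochhammer (\<gamma> / (x + \<gamma>)) q k * q_pochhammer_inf ((x + \<gamma>) / (1 + \<gamma>)) q *
       ((x + \<gamma>) / (1 + \<gamma>)) ^ k /
       (q_pochhammer q q k * q_pochhammer_inf (\<gamma> / (1 + \<gamma>)) q))"

lemma limit_q_stancu_basis_reading:
  fixes x \<gamma> q :: real
  assumes "0 \<le> x" "0 \<le> \<gamma>"
  shows "q_pochhammer (\<gamma> / (x + \<gamma>)) q k * ((x + \<gamma>) / (1 + \<gamma>)) ^ k =
         inverse ((1 + \<gamma>) ^ k) * (\<Prod>i<k. x + \<gamma> - \<gamma> * q ^ i)"
proof (cases "x + \<gamma> = 0")
  case True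
  then have "x = 0" "\<gamma> = 0" using assms by auto
  then show ?thesis by (cases k) (auto simp: q_pochhammer_def)
next
  case False
  have "q_pochhammer (\<gamma> / (x + \<gamma>)) q k * (x + \<gamma>) ^ k = (\<Prod>i<k. x + \<gamma> - \<gamma> * q ^ i)"
    unfolding q_pochhammer_def
    using False by (induction k) (auto simp: field_simps)
  then show ?thesis by (simp add: power_divide field_simps)
qed

definition limit_q_stancu :: "real \<Rightarrow> real \<Rightarrow> (real \<Rightarrow> real) \<Rightarrow> real \<Rightarrow> real" where
  "limit_q_stancu q \<alpha> f x =
     (if x = 1 then f 1 else (\<Sum>k. f (1 - q ^ k) * limit_q_stancu_basis q \<alpha> k x))"

end

theory Submission
  imports Defs
begin

text \<open>
  Each \<^term>\<open>q_stancu q \<alpha> n \<phi> x\<close> is an average of \<^term>\<open>\<phi>\<close> over the nodes \<open>[k]/[n] = (1 - q\<^sup>k)/(1 - q\<^sup>n)\<close>.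
  For fixed \<open>k\<close> these nodes converge to \<open>1 - q\<^sup>k\<close>, and they lie above this limit, so that
  for large \<open>k\<close> they are close to 1 whatever \<open>n\<close> is. Hence only finitely many indices contribute
  more than a small multiple of \<open>\<phi> - \<phi> 1\<close>, and uniform convergence of the averages follows from
  uniform convergence of each single weight (\<open>uniform_limit_weighted_sums\<close>). As \<open>x\<close> approaches 1,
  mass escapes to large indices; in the limit it sits at the point 1,
  where \<open>\<phi> - \<phi> 1\<close> vanishes.

  The substitution \<open>u = (x + \<gamma>)/(1 + \<gamma>)\<close>, \<open>v = \<gamma>/(1 + \<gamma>)\<close> turns all factors of the weights into \<open>1 - u q\<^sup>s\<close>, \<open>u - v q\<^sup>i\<close> and
  \<open>1 - v q\<^sup>i\<close>, up to powers of \<open>1 + \<gamma>\<close> that cancel. Three facts about the weights are then required.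
  \<^item> They sum to one, by a q-Vandermonde identity (\<open>q_vandermonde\<close>).
  \<^item> Each of them converges uniformly (\<open>uniform_limit_q_polya_weight\<close>), because the q-Pochhammer symbols
    \<open>(u; q)\<^sub>m\<close> converge to the infinite product with an error of at most \<open>q\<^sup>m / (1 - q)\<close> for all \<open>u\<close> in the
    unit interval.
  \<^item> The limit weights sum to one for \<open>x < 1\<close> (\<open>limit_q_polya_weight_sums\<close>) and vanish for \<open>x = 1\<close>, so that
    the abstract limit, which contains an atom at 1 for the escaped mass, agrees with both cases in the
    definition of the limit operator.
\<close>

section \<open>Averages over nodes that accumulate at 1\<close>

text \<open>
  The row weights \<^term>\<open>w n\<close> have total mass one, but their limits \<^term>\<open>l\<close> may have less: mass can escape
  to large indices. The nodes of large index lie close to 1, so the escaped mass is seen by \<^term>\<open>\<phi>\<close> as an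
  atom at 1, which is why the limit is stated for \<open>\<phi> - \<phi> 1\<close> with \<open>\<phi> 1\<close> added back. Given \<open>e\<close>, a cut-off
  \<open>K\<close> that does not depend on \<open>x\<close> makes all nodes beyond it so close to 1 that \<open>\<bar>\<phi> - \<phi> 1\<bar> \<le> e\<close> there.
  The bound \<open>s k \<le> t n k\<close> is what makes this \<open>K\<close> serve every row at once. Both tails are then at most
  \<open>e\<close>, and the \<open>K\<close> remaining terms converge uniformly.
\<close>
lemma uniform_limit_weighted_sums:
  fixes w :: "nat \<Rightarrow> nat \<Rightarrow> 'a \<Rightarrow> real" and t :: "nat \<Rightarrow> nat \<Rightarrow> real" and \<phi> :: "real \<Rightarrow> real"
  assumes w_nonneg: "\<And>n k x. x \<in> A \<Longrightarrow> k \<le> n \<Longrightarrow> 0 \<le> w n k x"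
    and w_sum: "\<And>n x. x \<in> A \<Longrightarrow> (\<Sum>k\<le>n. w n k x) = 1"
    and w_lim: "\<And>k. uniform_limit A (\<lambda>n. w n k) (l k) sequentially"
    and t_range: "\<And>n k. 0 < n \<Longrightarrow> k \<le> n \<Longrightarrow> s k \<le> t n k \<and> t n k \<le> 1"
    and t_lim: "\<And>k. (\<lambda>n. t n k) \<longlonglongrightarrow> s k"
    and s_range: "\<And>k. 0 \<le> s k \<and> s k \<le> 1"
    and s_lim: "s \<longlonglongrightarrow> 1"
    and cont: "continuous_on {0..1} \<phi>"
  shows "uniform_limit A (\<lambda>n x. \<Sum>k\<le>n. \<phi> (t n k) * w n k x)
           (\<lambda>x. \<phi> 1 + (\<Sum>k. (\<phi> (s k) - \<phi> 1) * l k x)) sequentially"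
proof -
  define \<psi> where "\<psi> y = \<phi> y - \<phi> 1" for y
  have \<psi>_cont: "continuous_on {0..1} \<psi>"
    unfolding \<psi>_def by (intro continuous_intros cont)
  have l_tendsto: "(\<lambda>n. w n k x) \<longlonglongrightarrow> l k x" if "x \<in> A" for k x
    using tendsto_uniform_limitI[OF w_lim that] .
  have l_nonneg: "0 \<le> l k x" if "x \<in> A" for k x
    by (rule tendsto_lowerbound[OF l_tendsto[OF that, of k]])
       (auto intro!: eventually_sequentiallyI[of k] w_nonneg that)
  have l_partial: "(\<Sum>k<N. l k x) \<le> 1" if "x \<in> A" for N x
  proof (rule tendsto_upperbound)
    show "(\<lambda>n. \<Sum>k<N. w n k x) \<longlonglongrightarrow> (\<Sum>k<N. l k x)"
      by (intro tendsto_sum l_tendsto that)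
    show "\<forall>\<^sub>F n in sequentially. (\<Sum>k<N. w n k x) \<le> 1"
    proof (rule eventually_sequentiallyI[of N])
      fix n assume "N \<le> n"
      then have "(\<Sum>k<N. w n k x) \<le> (\<Sum>k\<le>n. w n k x)"
        by (intro sum_mono2) (auto intro: w_nonneg that)
      then show "(\<Sum>k<N. w n k x) \<le> 1" using w_sum[OF that] by simp
    qed
  qed auto
  have l_le_1: "l k x \<le> 1" if "x \<in> A" for k x
  proof -
    have "l k x \<le> (\<Sum>j<Suc k. l j x)"
      by (rule member_le_sum) (auto intro: l_nonneg that)
    also have "\<dots> \<le> 1" by (rule l_partial[OF that])
    finally show ?thesis .
  qed
  have l_summable: "summable (\<lambda>k. l k x)" if "x \<in> A" for x
    by (rule summableI_nonneg_bounded[of _ 1]) (auto intro: l_nonneg l_partial that)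
  have head: "uniform_limit A (\<lambda>n x. \<Sum>k<K. \<psi> (t n k) * w n k x)
                (\<lambda>x. \<Sum>k<K. \<psi> (s k) * l k x) sequentially" for K
  proof (induction K)
    case 0
    show ?case by (simp add: uniform_limit_const)
  next
    case (Suc K)
    have "(\<lambda>n. \<psi> (t n K)) \<longlonglongrightarrow> \<psi> (s K)"
    proof (rule continuous_on_tendsto_compose[OF \<psi>_cont t_lim])
      show "s K \<in> {0..1}" using s_range by auto
      show "\<forall>\<^sub>F n in sequentially. t n K \<in> {0..1}"
      proof (rule eventually_sequentiallyI[of "Suc K"])
        fix n assume "Suc K \<le> n"
        then show "t n K \<in> {0..1}" using t_range[of n K] s_range[of K] by auto
      qed
    qed
    then have "uniform_limit A (\<lambda>n x. \<psi> (t n K)) (\<lambda>x. \<psi> (s K)) sequentially"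
      by (auto simp: uniform_limit_iff tendsto_iff elim: eventually_mono)
    moreover have "bounded (l K ` A)"
      by (rule boundedI[of _ 1]) (auto simp: abs_le_iff intro: l_le_1 order_trans[OF _ l_nonneg])
    ultimately have "uniform_limit A (\<lambda>n x. \<psi> (t n K) * w n K x) (\<lambda>x. \<psi> (s K) * l K x) sequentially"
      by (intro uniform_lim_mult w_lim) (auto intro: finite_imp_bounded finite_subset[of _ "{\<psi> (s K)}"])
    with Suc.IH show ?case
      by (simp add: uniform_limit_add)
  qed
  have "uniform_limit A (\<lambda>n x. \<Sum>k\<le>n. \<psi> (t n k) * w n k x)
          (\<lambda>x. \<Sum>k. \<psi> (s k) * l k x) sequentially"
  proof (rule uniform_limitI)
    fix e :: real assume "0 < e"
    define e' where "e' = e / 4"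
    have "0 < e'" "e = 4 * e'" using \<open>0 < e\<close> by (auto simp: e'_def)
    obtain d where "0 < d" and d: "\<And>y. y \<in> {0..1} \<Longrightarrow> dist y 1 < d \<Longrightarrow> dist (\<psi> y) (\<psi> 1) < e'"
      using \<psi>_cont \<open>0 < e'\<close> unfolding continuous_on_iff by (metis atLeastAtMost_iff order_refl zero_le_one)
    have \<psi>_small: "\<bar>\<psi> y\<bar> \<le> e'" if "1 - d < y" "0 \<le> y" "y \<le> 1" for y
      using d[of y] that by (auto simp: dist_real_def \<psi>_def)
    obtain K where K: "\<And>k. K \<le> k \<Longrightarrow> 1 - d < s k"
      using order_tendstoD(1)[OF s_lim, of "1 - d"] \<open>0 < d\<close> by (auto simp: eventually_sequentially)
    have "\<forall>\<^sub>F n in sequentially. \<forall>x\<in>A.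
            dist (\<Sum>k<K. \<psi> (t n k) * w n k x) (\<Sum>k<K. \<psi> (s k) * l k x) < e'"
      using uniform_limitD[OF head \<open>0 < e'\<close>] .
    moreover have "\<forall>\<^sub>F n in sequentially. max 1 K \<le> n" by (rule eventually_ge_at_top)
    ultimately show "\<forall>\<^sub>F n in sequentially. \<forall>x\<in>A.
            dist (\<Sum>k\<le>n. \<psi> (t n k) * w n k x) (\<Sum>k. \<psi> (s k) * l k x) < e"
    proof eventually_elim
      case (elim n)
      show ?case
      proof
        fix x assume x: "x \<in> A"
        have "\<bar>\<Sum>k=K..n. \<psi> (t n k) * w n k x\<bar> \<le> (\<Sum>k=K..n. e' * w n k x)"
        proof (rule order_trans[OF sum_abs sum_mono])
          fix k assume k: "k \<in> {K..n}"
          have "\<bar>\<psi> (t n k)\<bar> \<le> e'"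
            using K[of k] t_range[of n k] s_range[of k] k elim(2) by (intro \<psi>_small) auto
          then show "\<bar>\<psi> (t n k) * w n k x\<bar> \<le> e' * w n k x"
            using w_nonneg[OF x, of k n] k by (simp add: abs_mult mult_right_mono)
        qed
        also have "\<dots> \<le> (\<Sum>k\<le>n. e' * w n k x)"
          by (intro sum_mono2) (use \<open>0 < e'\<close> in \<open>auto intro!: mult_nonneg_nonneg w_nonneg x\<close>)
        also have "\<dots> = e'" by (simp add: w_sum[OF x] flip: sum_distrib_left)
        finally have tail_n: "\<bar>\<Sum>k=K..n. \<psi> (t n k) * w n k x\<bar> \<le> e'" .
        have term_le: "\<bar>\<psi> (s (k + K)) * l (k + K) x\<bar> \<le> e' * l (k + K) x" for k
        proof -
          have "\<bar>\<psi> (s (k + K))\<bar> \<le> e'"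
            using K[of "k + K"] s_range[of "k + K"] by (intro \<psi>_small) auto
          then show ?thesis using l_nonneg[OF x] by (simp add: abs_mult mult_right_mono)
        qed
        have l_tail: "summable (\<lambda>k. l (k + K) x)"
          by (rule summable_ignore_initial_segment[OF l_summable[OF x]])
        have tail_summable: "summable (\<lambda>k. \<bar>\<psi> (s (k + K)) * l (k + K) x\<bar>)"
          by (rule summable_comparison_test'[OF summable_mult[OF l_tail, of e'], of 0])
             (use term_le in auto)
        have "\<bar>\<Sum>k. \<psi> (s (k + K)) * l (k + K) x\<bar> \<le> (\<Sum>k. \<bar>\<psi> (s (k + K)) * l (k + K) x\<bar>)"
          by (rule summable_rabs[OF tail_summable])
        also have "\<dots> \<le> (\<Sum>k. e' * l (k + K) x)"
          by (intro suminf_le term_le tail_summable summable_mult l_tail)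
        also have "\<dots> = e' * (\<Sum>k. l (k + K) x)" by (rule suminf_mult[OF l_tail])
        also have "\<dots> \<le> e' * 1"
        proof (rule mult_left_mono)
          have "(\<Sum>k. l (k + K) x) = (\<Sum>k. l k x) - (\<Sum>k<K. l k x)"
            by (rule suminf_minus_initial_segment[OF l_summable[OF x]])
          also have "\<dots> \<le> (\<Sum>k. l k x)" by (simp add: sum_nonneg l_nonneg[OF x])
          also have "\<dots> \<le> 1" by (intro suminf_le_const l_summable l_partial x)
          finally show "(\<Sum>k. l (k + K) x) \<le> 1" .
        qed (use \<open>0 < e'\<close> in simp)
        finally have tail_inf: "\<bar>\<Sum>k. \<psi> (s (k + K)) * l (k + K) x\<bar> \<le> e'" by simp
        have "summable (\<lambda>k. \<psi> (s k) * l k x)"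
          using summable_rabs_cancel[OF tail_summable]
            summable_iff_shift[of "\<lambda>k. \<psi> (s k) * l k x" K] by simp
        then have "(\<Sum>k. \<psi> (s k) * l k x) =
              (\<Sum>k. \<psi> (s (k + K)) * l (k + K) x) + (\<Sum>k<K. \<psi> (s k) * l k x)"
          by (rule suminf_split_initial_segment)
        moreover have "(\<Sum>k\<le>n. \<psi> (t n k) * w n k x) =
              (\<Sum>k<K. \<psi> (t n k) * w n k x) + (\<Sum>k=K..n. \<psi> (t n k) * w n k x)"
        proof -
          have "{..n} = {..<K} \<union> {K..n}" using elim(2) by auto
          then show ?thesis by (simp add: sum.union_disjoint ivl_disj_int)
        qed
        moreover have "dist (\<Sum>k<K. \<psi> (t n k) * w n k x) (\<Sum>k<K. \<psi> (s k) * l k x) < e'"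
          using elim(1) x by blast
        ultimately show "dist (\<Sum>k\<le>n. \<psi> (t n k) * w n k x) (\<Sum>k. \<psi> (s k) * l k x) < e"
          using tail_n tail_inf \<open>e = 4 * e'\<close> \<open>0 < e'\<close> unfolding dist_real_def by linarith
      qed
    qed
  qed
  then have "uniform_limit A (\<lambda>n x. \<phi> 1 + (\<Sum>k\<le>n. \<psi> (t n k) * w n k x))
          (\<lambda>x. \<phi> 1 + (\<Sum>k. \<psi> (s k) * l k x)) sequentially"
    by (intro uniform_limit_add uniform_limit_const)
  moreover have "(\<Sum>k\<le>n. \<phi> (t n k) * w n k x) = \<phi> 1 + (\<Sum>k\<le>n. \<psi> (t n k) * w n k x)"
    if "x \<in> A" for n x
    by (simp add: \<psi>_def left_diff_distrib sum_subtractf w_sum[OF that] flip: sum_distrib_left)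
  ultimately show ?thesis
    unfolding \<psi>_def by (subst uniform_limit_cong'[OF _ refl]) (auto simp: \<psi>_def)
qed

section \<open>The weights in q-Pochhammer form\<close>

text \<open>
  With \<open>u = (x + \<gamma>) / (1 + \<gamma>)\<close> and \<open>v = \<gamma> / (1 + \<gamma>)\<close>, each linear factor of a Stancu basis function is \<open>1 + \<gamma>\<close>
  times one of the factors here, and the powers of \<open>1 + \<gamma>\<close> cancel. In these variables the weights are the
  probabilities of a q-Polya distribution.
\<close>
definition q_polya_weight :: "real \<Rightarrow> real \<Rightarrow> nat \<Rightarrow> nat \<Rightarrow> real \<Rightarrow> real" where
  "q_polya_weight q v n k u =
     q_binomial q n k * (\<Prod>i<k. u - v * q ^ i) * q_pochhammer u q (n - k) / q_pochhammer v q n"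

text \<open>
  The product over \<open>i < k\<close> is written out in both definitions because it remains meaningful at \<open>u = 0\<close>;
  the usual form \<open>q_pochhammer (v / u) q k * u ^ k\<close> contains the quotient \<open>v / u\<close>.
\<close>
definition limit_q_polya_weight :: "real \<Rightarrow> real \<Rightarrow> nat \<Rightarrow> real \<Rightarrow> real" where
  "limit_q_polya_weight q v k u =
     (\<Prod>i<k. u - v * q ^ i) * q_pochhammer_inf u q / (q_pochhammer q q k * q_pochhammer_inf v q)"

section \<open>The q-Vandermonde identity\<close>

lemma q_pochhammer_0 [simp]: "q_pochhammer a q 0 = 1"
  by (simp add: q_pochhammer_def)

lemma q_pochhammer_Suc [simp]: "q_pochhammer a q (Suc m) = q_pochhammer a q m * (1 - a * q ^ m)"
  by (simp add: q_pochhammer_def)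

context
  fixes q :: real
  assumes q: "0 < q" "q < 1"
begin

lemma q_int_eq: "q_int q i = (1 - q ^ i) / (1 - q)"
  unfolding q_int_def using q by (simp add: sum_gp_strict)

lemma q_fact_eq: "q_fact q n = q_pochhammer q q n / (1 - q) ^ n"
  by (induction n) (simp_all add: q_fact_def q_int_eq)

lemma mult_power_in_unit: "0 \<le> a \<Longrightarrow> a \<le> 1 \<Longrightarrow> 0 \<le> a * q ^ j \<and> a * q ^ j \<le> 1"
  using q by (simp add: mult_le_one power_le_one)

lemma mult_power_less_1: "0 \<le> a \<Longrightarrow> a < 1 \<Longrightarrow> a * q ^ j < 1"
  using q mult_left_le[of "q ^ j" a] by (simp add: power_le_one)

lemma q_pochhammer_nonneg: "0 \<le> a \<Longrightarrow> a \<le> 1 \<Longrightarrow> 0 \<le> q_pochhammer a q m"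
  unfolding q_pochhammer_def using mult_power_in_unit[of a] by (intro prod_nonneg) auto

lemma q_pochhammer_le_1: "0 \<le> a \<Longrightarrow> a \<le> 1 \<Longrightarrow> q_pochhammer a q m \<le> 1"
  unfolding q_pochhammer_def using mult_power_in_unit[of a] by (intro prod_le_1) auto

lemma q_pochhammer_pos: "0 \<le> a \<Longrightarrow> a < 1 \<Longrightarrow> 0 < q_pochhammer a q m"
  unfolding q_pochhammer_def using mult_power_less_1[of a] by (intro prod_pos) auto

lemma q_binomial_eq:
  assumes "k \<le> n"
  shows "q_binomial q n k = q_pochhammer q q n / (q_pochhammer q q k * q_pochhammer q q (n - k))"
proof -
  have "(1 - q) ^ n = (1 - q) ^ k * (1 - q) ^ (n - k)"
    using assms by (simp flip: power_add)
  then show ?thesis using q by (simp add: q_binomial_def q_fact_eq)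
qed

lemma q_binomial_nonneg: "k \<le> n \<Longrightarrow> 0 \<le> q_binomial q n k"
  using q by (simp add: q_binomial_eq q_pochhammer_nonneg)

lemma q_binomial_n_0: "q_binomial q n 0 = 1"
  using q q_pochhammer_pos[of q n] by (simp add: q_binomial_eq)

lemma q_binomial_n_n: "q_binomial q n n = 1"
  using q q_pochhammer_pos[of q n] by (simp add: q_binomial_eq)

lemma q_binomial_Suc_Suc:
  assumes "Suc k \<le> n"
  shows "q_binomial q (Suc n) (Suc k) = q_binomial q n (Suc k) + q ^ (n - k) * q_binomial q n k"
proof -
  obtain m where n: "n = Suc (k + m)" using assms by (metis add_Suc less_eqE)
  have nz: "q_pochhammer q q j \<noteq> 0" "1 - q * q ^ j \<noteq> 0" for j
    using q q_pochhammer_pos[of q j] mult_power_less_1[of q j] by auto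
  have "n - k = Suc m" "Suc n - Suc k = Suc m" "n - Suc k = m" "Suc k \<le> Suc n" "k \<le> n"
    using n by auto
  then show ?thesis
    using nz[of k] nz[of m] nz[of n]
    by (simp add: q_binomial_eq assms divide_simps) (simp add: n algebra_simps power_add)
qed

text \<open>
  A form of the q-Vandermonde identity, which makes the weights sum to one. By the q-Pascal
  rule the term with index \<open>k\<close> of row \<open>n\<close> is passed on to the indices \<open>k\<close> and \<open>k + 1\<close> of the next row,
  with the factors \<open>1 - u q\<^sup>n\<^sup>-\<^sup>k\<close> and \<open>q\<^sup>n\<^sup>-\<^sup>k (u - v q\<^sup>k)\<close>. These add up to \<open>1 - v q\<^sup>n\<close>, which is
  independent of \<open>k\<close>; so each row sum is the previous one times the next factor of the q-Pochhammer
  symbol on the right.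
\<close>
lemma q_vandermonde:
  "(\<Sum>k\<le>n. q_binomial q n k * (\<Prod>i<k. u - v * q ^ i) * q_pochhammer u q (n - k)) = q_pochhammer v q n"
proof (induction n)
  case 0
  show ?case by (simp add: q_binomial_n_0)
next
  case (Suc n)
  define h where "h k = (\<Prod>i<k. u - v * q ^ i)" for k
  define c where "c k = q_binomial q n k * h k * q_pochhammer u q (n - k)" for k
  have h_Suc: "h (Suc k) = h k * (u - v * q ^ k)" for k by (simp add: h_def)
  have "(\<Sum>k\<le>Suc n. q_binomial q (Suc n) k * h k * q_pochhammer u q (Suc n - k)) =
        q_pochhammer u q (Suc n)
        + (\<Sum>k<n. q_binomial q (Suc n) (Suc k) * h (Suc k) * q_pochhammer u q (n - k))
        + h (Suc n)"
    unfolding sum.atMost_Suc_shift lessThan_Suc_atMost[of n, symmetric] sum.lessThan_Suc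
    by (simp add: q_binomial_n_0 q_binomial_n_n h_def)
  \<comment> \<open>The q-Pascal rule is available for the inner indices only; the two extreme terms stay apart until
    the two sums are completed.\<close>
  also have "(\<Sum>k<n. q_binomial q (Suc n) (Suc k) * h (Suc k) * q_pochhammer u q (n - k)) =
        (\<Sum>k<n. c (Suc k) * (1 - u * q ^ (n - Suc k))) + (\<Sum>k<n. c k * (q ^ (n - k) * (u - v * q ^ k)))"
    unfolding sum.distrib[symmetric]
  proof (rule sum.cong[OF refl])
    fix k assume "k \<in> {..<n}"
    then have k: "Suc k \<le> n" and "n - k = Suc (n - Suc k)" by auto
    then show "q_binomial q (Suc n) (Suc k) * h (Suc k) * q_pochhammer u q (n - k) =
        c (Suc k) * (1 - u * q ^ (n - Suc k)) + c k * (q ^ (n - k) * (u - v * q ^ k))"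
      by (simp add: q_binomial_Suc_Suc c_def h_Suc algebra_simps)
  qed
  also have "q_pochhammer u q (Suc n) + ((\<Sum>k<n. c (Suc k) * (1 - u * q ^ (n - Suc k)))
        + (\<Sum>k<n. c k * (q ^ (n - k) * (u - v * q ^ k)))) + h (Suc n) =
        (\<Sum>k\<le>n. c k * (1 - u * q ^ (n - k))) + (\<Sum>k\<le>n. c k * (q ^ (n - k) * (u - v * q ^ k)))"
  proof -
    have "(\<Sum>k\<le>n. c k * (1 - u * q ^ (n - k))) =
          q_pochhammer u q (Suc n) + (\<Sum>k<n. c (Suc k) * (1 - u * q ^ (n - Suc k)))"
      by (subst sum.atMost_shift) (simp add: c_def q_binomial_n_0 h_def)
    moreover have "(\<Sum>k\<le>n. c k * (q ^ (n - k) * (u - v * q ^ k))) =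
          (\<Sum>k<n. c k * (q ^ (n - k) * (u - v * q ^ k))) + h (Suc n)"
      by (simp add: c_def q_binomial_n_n h_def flip: lessThan_Suc_atMost)
    ultimately show ?thesis by simp
  qed
  also have "\<dots> = (\<Sum>k\<le>n. c k * (1 - v * q ^ n))"
    unfolding sum.distrib[symmetric]
  proof (rule sum.cong[OF refl])
    fix k assume "k \<in> {..n}"
    then have "q ^ n = q ^ (n - k) * q ^ k" by (simp flip: power_add)
    then show "c k * (1 - u * q ^ (n - k)) + c k * (q ^ (n - k) * (u - v * q ^ k)) = c k * (1 - v * q ^ n)"
      by (simp add: algebra_simps)
  qed
  also have "\<dots> = q_pochhammer v q (Suc n)"
    using Suc.IH by (simp add: c_def h_def flip: sum_distrib_right)
  finally show ?case by (simp only: h_def)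
qed

section \<open>Convergence of q-Pochhammer symbols\<close>

lemma convergent_prod_q_pochhammer: "convergent_prod (\<lambda>j. 1 - a * q ^ j)"
proof -
  have "summable (\<lambda>j. \<bar>a\<bar> * q ^ j)"
    using q by (intro summable_mult summable_geometric) auto
  then show ?thesis
    using q by (intro abs_convergent_prod_imp_convergent_prod summable_imp_abs_convergent_prod)
      (simp add: abs_mult)
qed

lemma q_pochhammer_tendsto: "q_pochhammer a q \<longlonglongrightarrow> q_pochhammer_inf a q"
proof -
  have "(\<lambda>n. q_pochhammer a q (Suc n)) \<longlonglongrightarrow> q_pochhammer_inf a q"
    using convergent_prod_LIMSEQ[OF convergent_prod_q_pochhammer]
    unfolding q_pochhammer_def q_pochhammer_inf_def lessThan_Suc_atMost .
  then show ?thesis by (simp add: filterlim_sequentially_Suc del: q_pochhammer_Suc)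
qed

lemma q_pochhammer_inf_pos:
  assumes "0 \<le> a" "a < 1"
  shows "0 < q_pochhammer_inf a q"
proof -
  have "q_pochhammer_inf a q \<noteq> 0"
    unfolding q_pochhammer_inf_def
    using mult_power_less_1[OF assms] by (intro prodinf_nonzero convergent_prod_q_pochhammer) (auto simp: less_le)
  moreover have "0 \<le> q_pochhammer_inf a q"
    using assms by (intro LIMSEQ_le_const[OF q_pochhammer_tendsto]) (auto intro!: exI[of _ 0] q_pochhammer_nonneg)
  ultimately show ?thesis by simp
qed

lemma decseq_q_pochhammer: "0 \<le> a \<Longrightarrow> a \<le> 1 \<Longrightarrow> decseq (q_pochhammer a q)"
  using mult_power_in_unit[of a] q_pochhammer_nonneg[of a]
  by (intro decseq_SucI) (simp add: mult_left_le)

lemma q_pochhammer_inf_le_q_pochhammer: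
  "0 \<le> a \<Longrightarrow> a \<le> 1 \<Longrightarrow> q_pochhammer_inf a q \<le> q_pochhammer a q m"
  by (rule decseq_ge[OF decseq_q_pochhammer q_pochhammer_tendsto])

text \<open>
  Passing from \<open>m\<close> to \<open>m + 1\<close> decreases the product by at most \<open>q\<^sup>m\<close>, and these decrements form a
  geometric series. The resulting error bound does not involve \<^term>\<open>a\<close>, so the convergence is
  uniform on the closed interval, including \<open>a = 1\<close>, where the infinite product vanishes.
\<close>
lemma q_pochhammer_le_inf_plus:
  assumes "0 \<le> a" "a \<le> 1"
  shows "q_pochhammer a q m \<le> q_pochhammer_inf a q + q ^ m / (1 - q)"
proof -
  have "q_pochhammer a q m - q ^ m / (1 - q) \<le> q_pochhammer_inf a q - 0"
  proof (rule incseq_le)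
    \<comment> \<open>Subtracting the remaining part of the geometric series turns the decreasing sequence into an increasing one.\<close>
    show "incseq (\<lambda>m. q_pochhammer a q m - q ^ m / (1 - q))"
    proof (rule incseq_SucI)
      fix m
      have "q_pochhammer a q m * a * q ^ m \<le> q ^ m"
        using q assms q_pochhammer_nonneg[OF assms, of m] q_pochhammer_le_1[OF assms, of m]
        by (simp add: mult_le_one)
      moreover have "q ^ m / (1 - q) - q ^ Suc m / (1 - q) = q ^ m"
        using q by (simp add: divide_simps) (simp add: algebra_simps)
      ultimately show "q_pochhammer a q m - q ^ m / (1 - q)
          \<le> q_pochhammer a q (Suc m) - q ^ Suc m / (1 - q)"
        by (simp add: algebra_simps)
    qed
    have "(\<lambda>m. q ^ m / (1 - q)) \<longlonglongrightarrow> 0"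
      using q by (intro tendsto_divide_zero LIMSEQ_realpow_zero) auto
    then show "(\<lambda>m. q_pochhammer a q m - q ^ m / (1 - q)) \<longlonglongrightarrow> q_pochhammer_inf a q - 0"
      by (intro tendsto_diff q_pochhammer_tendsto)
  qed
  then show ?thesis by simp
qed

lemma uniform_limit_q_pochhammer:
  "uniform_limit {0..1} (\<lambda>m a. q_pochhammer a q m) (\<lambda>a. q_pochhammer_inf a q) sequentially"
proof (rule uniform_limitI)
  fix e :: real assume "0 < e"
  have "(\<lambda>m. q ^ m / (1 - q)) \<longlonglongrightarrow> 0"
    using q by (intro tendsto_divide_zero LIMSEQ_realpow_zero) auto
  then have "\<forall>\<^sub>F m in sequentially. q ^ m / (1 - q) < e"
    using \<open>0 < e\<close> by (rule order_tendstoD)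
  then show "\<forall>\<^sub>F m in sequentially. \<forall>a\<in>{0..1}. dist (q_pochhammer a q m) (q_pochhammer_inf a q) < e"
  proof eventually_elim
    case (elim m)
    show ?case
    proof
      fix a :: real assume "a \<in> {0..1}"
      then show "dist (q_pochhammer a q m) (q_pochhammer_inf a q) < e"
        using elim q_pochhammer_inf_le_q_pochhammer[of a m] q_pochhammer_le_inf_plus[of a m]
        by (simp add: dist_real_def)
    qed
  qed
qed

section \<open>Uniform convergence and total mass of the weights\<close>

context
  fixes v :: real
  assumes v: "0 \<le> v" "v < 1"
begin

lemma polya_factor_bounds: "v \<le> u \<Longrightarrow> 0 \<le> u - v * q ^ i \<and> u - v * q ^ i \<le> u"
  using q v mult_left_le[of "q ^ i" v] by (simp add: power_le_one)

lemma polya_prod_nonneg: "v \<le> u \<Longrightarrow> 0 \<le> (\<Prod>i<k. u - v * q ^ i)"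
  using polya_factor_bounds by (intro prod_nonneg) auto

lemma polya_prod_le_power: "v \<le> u \<Longrightarrow> (\<Prod>i<k. u - v * q ^ i) \<le> u ^ k"
  using prod_mono[of "{..<k}" "\<lambda>i. u - v * q ^ i" "\<lambda>_. u"] polya_factor_bounds by simp

lemma q_polya_weight_nonneg:
  assumes "v \<le> u" "u \<le> 1" "k \<le> n"
  shows "0 \<le> q_polya_weight q v n k u"
  unfolding q_polya_weight_def using assms v
  by (intro divide_nonneg_nonneg mult_nonneg_nonneg q_binomial_nonneg polya_prod_nonneg q_pochhammer_nonneg) auto

lemma sum_q_polya_weight: "(\<Sum>k\<le>n. q_polya_weight q v n k u) = 1"
  unfolding q_polya_weight_def sum_divide_distrib[symmetric] q_vandermonde
  using q_pochhammer_pos[OF v, of n] by simp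

lemma uniform_limit_q_polya_weight:
  "uniform_limit {v..1} (\<lambda>n. q_polya_weight q v n k) (limit_q_polya_weight q v k) sequentially"
proof -
  have filter_minus: "filterlim (\<lambda>n. n - k) sequentially sequentially"
    by (rule filterlim_minus_const_nat_at_top)
  define c where "c n = q_pochhammer q q n / (q_pochhammer q q k * q_pochhammer q q (n - k)) / q_pochhammer v q n" for n
  have "c \<longlonglongrightarrow> q_pochhammer_inf q q / (q_pochhammer q q k * q_pochhammer_inf q q) / q_pochhammer_inf v q"
    unfolding c_def using q v q_pochhammer_pos[of q k] q_pochhammer_inf_pos[of q] q_pochhammer_inf_pos[of v]
    by (intro tendsto_intros q_pochhammer_tendsto filterlim_compose[OF q_pochhammer_tendsto filter_minus]) auto
  then have c_lim: "c \<longlonglongrightarrow> 1 / (q_pochhammer q q k * q_pochhammer_inf v q)"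
    using q q_pochhammer_inf_pos[of q] by simp
  have prod_bounded: "\<bar>\<Prod>i<k. u - v * q ^ i\<bar> \<le> 1" if "u \<in> {v..1}" for u
    using that v polya_prod_nonneg[of u k] polya_prod_le_power[of u k] power_le_one[of u k] by auto
  have inf_bounded: "\<bar>q_pochhammer_inf u q\<bar> \<le> 1" if "u \<in> {v..1}" for u
    using that v q_pochhammer_inf_le_q_pochhammer[of u 0] q_pochhammer_inf_pos[of u]
      LIMSEQ_le_const[OF q_pochhammer_tendsto[of u], of 0] q_pochhammer_nonneg[of u] by auto
  have "uniform_limit {v..1} (\<lambda>n u. q_pochhammer u q (n - k)) (\<lambda>u. q_pochhammer_inf u q) sequentially"
    using filterlim_compose[OF uniform_limit_on_subset[OF uniform_limit_q_pochhammer, of "{v..1}"] filter_minus] v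
    by (auto simp: o_def)
  then have prod_lim: "uniform_limit {v..1} (\<lambda>n u. (\<Prod>i<k. u - v * q ^ i) * q_pochhammer u q (n - k))
      (\<lambda>u. (\<Prod>i<k. u - v * q ^ i) * q_pochhammer_inf u q) sequentially"
    by (intro uniform_lim_mult uniform_limit_const)
       (auto intro!: boundedI[of _ 1] prod_bounded inf_bounded)
  have const_lim: "uniform_limit {v..1} (\<lambda>n u. c n) (\<lambda>u. 1 / (q_pochhammer q q k * q_pochhammer_inf v q)) sequentially"
    using c_lim by (auto simp: uniform_limit_iff tendsto_iff elim: eventually_mono)
  have "uniform_limit {v..1} (\<lambda>n u. c n * ((\<Prod>i<k. u - v * q ^ i) * q_pochhammer u q (n - k)))
      (\<lambda>u. 1 / (q_pochhammer q q k * q_pochhammer_inf v q) * ((\<Prod>i<k. u - v * q ^ i) * q_pochhammer_inf u q)) sequentially"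
  proof (rule uniform_lim_mult[OF const_lim prod_lim])
    show "bounded ((\<lambda>u. (\<Prod>i<k. u - v * q ^ i) * q_pochhammer_inf u q) ` {v..1})"
    proof (rule boundedI, safe)
      fix u assume "u \<in> {v..1}"
      then show "norm ((\<Prod>i<k. u - v * q ^ i) * q_pochhammer_inf u q) \<le> 1"
        unfolding real_norm_def abs_mult by (intro mult_le_one prod_bounded inf_bounded) auto
    qed
  qed (simp_all add: image_constant_conv)
  moreover have "\<forall>\<^sub>F n in sequentially. \<forall>u\<in>{v..1}.
      c n * ((\<Prod>i<k. u - v * q ^ i) * q_pochhammer u q (n - k)) = q_polya_weight q v n k u"
    by (rule eventually_sequentiallyI[of k]) (simp add: q_polya_weight_def c_def q_binomial_eq)
  ultimately show ?thesis
    by (rule uniform_limit_cong[THEN iffD1, rotated 2]) (simp_all add: limit_q_polya_weight_def)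
qed

text \<open>
  No mass escapes as long as \<^term>\<open>u\<close> stays below 1: the weights of every row are dominated by one
  geometric series with ratio \<^term>\<open>u\<close>, so Tannery's theorem carries the row sums over to the limit.
\<close>
lemma limit_q_polya_weight_sums:
  assumes "v \<le> u" "u < 1"
  shows "(\<lambda>k. limit_q_polya_weight q v k u) sums 1"
proof -
  define M where "M k = u ^ k / (q_pochhammer_inf q q * q_pochhammer_inf v q)" for k
  \<comment> \<open>Each row is extended by zero to a series; the truncated subtraction in the weights would give other values.\<close>
  define a where "a k n = (if k \<le> n then q_polya_weight q v n k u else 0)" for k n
  have u: "0 \<le> u" using v assms by simp
  have pos: "0 < q_pochhammer_inf q q" "0 < q_pochhammer_inf v q"
    using q v by (auto intro: q_pochhammer_inf_pos)
  have bound: "\<bar>a k n\<bar> \<le> M k" for k n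
  proof (cases "k \<le> n")
    case True
    \<comment> \<open>Dividing \<open>(q; q)\<^sub>n\<close> by \<open>(q; q)\<^sub>n\<^sub>-\<^sub>k\<close> first leaves a quotient of at most 1, while every other
      denominator is bounded below by its infinite product.\<close>
    have "q_polya_weight q v n k u =
        (q_pochhammer q q n / q_pochhammer q q (n - k)) * (\<Prod>i<k. u - v * q ^ i) * q_pochhammer u q (n - k)
        / (q_pochhammer q q k * q_pochhammer v q n)"
      using True by (simp add: q_polya_weight_def q_binomial_eq)
    also have "\<dots> \<le> 1 * u ^ k * 1 / (q_pochhammer_inf q q * q_pochhammer_inf v q)"
    proof (intro frac_le mult_mono)
      show "q_pochhammer q q n / q_pochhammer q q (n - k) \<le> 1"
        using q q_pochhammer_pos[of q "n - k"] decseqD[OF decseq_q_pochhammer, of q "n - k" n] by simp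
    qed (use assms q v u pos in \<open>auto intro!: polya_prod_le_power polya_prod_nonneg q_pochhammer_le_1
          q_pochhammer_nonneg q_pochhammer_inf_le_q_pochhammer mult_nonneg_nonneg mult_le_one divide_nonneg_nonneg
          less_imp_le[OF q_pochhammer_pos] mult_pos_pos\<close>)
    finally show ?thesis
      using True assms q_polya_weight_nonneg[of u k n] by (simp add: a_def M_def)
  next
    case False
    then show ?thesis using u pos by (simp add: a_def M_def)
  qed
  have "summable M"
    unfolding M_def using u assms by (intro summable_divide summable_geometric) auto
  have lim: "(\<lambda>n. a k n) \<longlonglongrightarrow> limit_q_polya_weight q v k u" for k
  proof (rule Lim_transform_eventually)
    show "(\<lambda>n. q_polya_weight q v n k u) \<longlonglongrightarrow> limit_q_polya_weight q v k u"
      using assms by (intro tendsto_uniform_limitI[OF uniform_limit_q_polya_weight]) auto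
    show "\<forall>\<^sub>F n in sequentially. q_polya_weight q v n k u = a k n"
      by (rule eventually_sequentiallyI[of k]) (simp add: a_def)
  qed
  have "summable (\<lambda>k. norm (limit_q_polya_weight q v k u)) \<and>
      (\<lambda>n. \<Sum>k. a k n) \<longlonglongrightarrow> (\<Sum>k. limit_q_polya_weight q v k u)"
  proof (rule conjunct2[OF tannerys_theorem])
    show "\<forall>\<^sub>F (k, n) in sequentially \<times>\<^sub>F sequentially. norm (a k n) \<le> M k"
      using bound by (intro always_eventually) auto
  qed (use lim \<open>summable M\<close> in auto)
  moreover have "(\<Sum>k. a k n) = 1" for n
  proof -
    have "(\<Sum>k. a k n) = (\<Sum>k\<le>n. a k n)" by (rule suminf_finite) (auto simp: a_def)
    also have "\<dots> = (\<Sum>k\<le>n. q_polya_weight q v n k u)" by (simp add: a_def)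
    finally show ?thesis by (simp add: sum_q_polya_weight)
  qed
  ultimately have "summable (\<lambda>k. limit_q_polya_weight q v k u)" "(\<Sum>k. limit_q_polya_weight q v k u) = 1"
    by (auto intro: summable_norm_cancel simp: LIMSEQ_const_iff)
  then show ?thesis by (simp add: sums_iff)
qed

end

end

lemma q_pochhammer_inf_1:
  assumes "0 < q" "q < 1"
  shows "q_pochhammer_inf 1 q = 0"
proof (rule LIMSEQ_unique[OF q_pochhammer_tendsto[OF assms]])
  show "q_pochhammer 1 q \<longlonglongrightarrow> 0"
    by (rule tendsto_eventually, rule eventually_sequentiallyI[of 1])
       (auto simp: q_pochhammer_def intro!: prod_zero bexI[of _ 0])
qed

lemma limit_q_polya_weight_at_1:
  assumes "0 < q" "q < 1"
  shows "limit_q_polya_weight q v k 1 = 0"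
  using q_pochhammer_inf_1[OF assms] by (simp add: limit_q_polya_weight_def)

section \<open>The limit of the q-Stancu operators\<close>

lemma q_stancu_basis_eq_q_polya_weight:
  assumes "0 < q" "q < 1" "0 \<le> \<alpha>" "k \<le> n"
  defines "\<gamma> \<equiv> stancu_gamma q \<alpha>"
  shows "q_stancu_basis q \<alpha> n k x = q_polya_weight q (\<gamma> / (1 + \<gamma>)) n k ((x + \<gamma>) / (1 + \<gamma>))"
proof -
  have \<gamma>: "0 \<le> \<gamma>" using assms by (simp add: stancu_gamma_def)
  have \<alpha>_q_int: "\<alpha> * q_int q i = \<gamma> * (1 - q ^ i)" for i
    using assms by (simp add: q_int_eq stancu_gamma_def)
  have "x + \<alpha> * q_int q i = (1 + \<gamma>) * ((x + \<gamma>) / (1 + \<gamma>) - \<gamma> / (1 + \<gamma>) * q ^ i)" for i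
    unfolding \<alpha>_q_int using \<gamma> by (simp add: divide_simps) (simp add: algebra_simps)
  moreover have "1 - q ^ i * x + \<alpha> * q_int q i = (1 + \<gamma>) * (1 - (x + \<gamma>) / (1 + \<gamma>) * q ^ i)" for i
    unfolding \<alpha>_q_int using \<gamma> by (simp add: divide_simps) (simp add: algebra_simps)
  moreover have "1 + \<alpha> * q_int q i = (1 + \<gamma>) * (1 - \<gamma> / (1 + \<gamma>) * q ^ i)" for i
    unfolding \<alpha>_q_int using \<gamma> by (simp add: divide_simps) (simp add: algebra_simps)
  moreover have "(1 + \<gamma>) ^ n = (1 + \<gamma>) ^ k * (1 + \<gamma>) ^ (n - k)"
    using \<open>k \<le> n\<close> by (simp flip: power_add)
  ultimately show ?thesis
    using \<gamma> by (simp add: q_stancu_basis_def q_polya_weight_def q_pochhammer_def prod.distrib)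
qed

lemma limit_q_stancu_basis_eq_limit_q_polya_weight:
  assumes "0 < q" "q < 1" "0 \<le> \<alpha>" "0 \<le> x"
  defines "\<gamma> \<equiv> stancu_gamma q \<alpha>"
  shows "limit_q_stancu_basis q \<alpha> k x = limit_q_polya_weight q (\<gamma> / (1 + \<gamma>)) k ((x + \<gamma>) / (1 + \<gamma>))"
proof -
  have \<gamma>: "0 \<le> \<gamma>" using assms by (simp add: stancu_gamma_def)
  have "inverse ((1 + \<gamma>) ^ k) * (\<Prod>i<k. x + \<gamma> - \<gamma> * q ^ i) =
      (\<Prod>i<k. inverse (1 + \<gamma>) * (x + \<gamma> - \<gamma> * q ^ i))"
    by (simp add: prod.distrib power_inverse)
  also have "\<dots> = (\<Prod>i<k. (x + \<gamma>) / (1 + \<gamma>) - \<gamma> / (1 + \<gamma>) * q ^ i)"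
    by (simp add: divide_inverse algebra_simps)
  finally show ?thesis
    using limit_q_stancu_basis_reading[OF \<open>0 \<le> x\<close> \<gamma>, of q k]
    by (simp add: limit_q_stancu_basis_def limit_q_polya_weight_def Let_def mult.commute mult.left_commute
        flip: \<gamma>_def)
qed

theorem theorem3p6:
  fixes q \<alpha> :: real and \<phi> :: "real \<Rightarrow> real"
  assumes "0 < q" and "q < 1" and "0 \<le> \<alpha>" and "continuous_on {0..1} \<phi>"
  shows "uniform_limit {0..1} (\<lambda>n x. q_stancu q \<alpha> n \<phi> x) (\<lambda>x. limit_q_stancu q \<alpha> \<phi> x) sequentially"
proof -
  note q = assms(1,2)
  define \<gamma> where "\<gamma> = stancu_gamma q \<alpha>"
  define v where "v = \<gamma> / (1 + \<gamma>)"
  define u where "u x = (x + \<gamma>) / (1 + \<gamma>)" for x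
  define l where "l k x = limit_q_polya_weight q v k (u x)" for k x
  have \<gamma>: "0 \<le> \<gamma>" using assms by (simp add: \<gamma>_def stancu_gamma_def)
  have v: "0 \<le> v" "v < 1" using \<gamma> by (auto simp: v_def divide_simps)
  have u: "v \<le> u x" "u x \<le> 1" if "x \<in> {0..1}" for x
    using that \<gamma> by (auto simp: u_def v_def divide_simps)
  have nodes_lim: "(\<lambda>k. 1 - q ^ k) \<longlonglongrightarrow> 1"
    using q tendsto_diff[OF tendsto_const[of "1::real"] LIMSEQ_realpow_zero[of q]] by simp
  have node_eq: "q_int q k / q_int q n = (1 - q ^ k) / (1 - q ^ n)" for k n
    using q by (simp add: q_int_eq)
  have lim: "uniform_limit {0..1} (\<lambda>n x. \<Sum>k\<le>n. \<phi> (q_int q k / q_int q n) * q_polya_weight q v n k (u x))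
      (\<lambda>x. \<phi> 1 + (\<Sum>k. (\<phi> (1 - q ^ k) - \<phi> 1) * l k x)) sequentially"
  proof (rule uniform_limit_weighted_sums)
    show "uniform_limit {0..1} (\<lambda>n x. q_polya_weight q v n k (u x)) (l k) sequentially" for k
      unfolding l_def using u
      by (intro uniform_limit_compose'[OF uniform_limit_q_polya_weight[OF q v]]) auto
    show "1 - q ^ k \<le> q_int q k / q_int q n \<and> q_int q k / q_int q n \<le> 1" if "0 < n" "k \<le> n" for n k
    proof -
      have "0 < 1 - q ^ n" "q ^ n \<le> q ^ k" "q ^ k \<le> 1" "0 < q ^ n"
        using that q by (auto intro: power_decreasing power_le_one simp: power_less_one_iff)
      then show ?thesis
        unfolding node_eq using mult_left_le[of "1 - q ^ n" "1 - q ^ k"] by (simp add: divide_simps)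
    qed
    show "(\<lambda>n. q_int q k / q_int q n) \<longlonglongrightarrow> 1 - q ^ k" for k
      unfolding node_eq using tendsto_divide[OF tendsto_const nodes_lim, of "1 - q ^ k"] by simp
    show "0 \<le> 1 - q ^ k \<and> 1 - q ^ k \<le> 1" for k
      using q by (simp add: power_le_one)
  qed (use q v u nodes_lim assms(4) in \<open>auto intro: q_polya_weight_nonneg sum_q_polya_weight\<close>)
  have prelimit_eq: "q_stancu q \<alpha> n \<phi> x =
      (\<Sum>k\<le>n. \<phi> (q_int q k / q_int q n) * q_polya_weight q v n k (u x))" for n x
    unfolding q_stancu_def u_def v_def \<gamma>_def
    by (intro sum.cong refl) (simp add: q_stancu_basis_eq_q_polya_weight assms)
  have limit_eq: "limit_q_stancu q \<alpha> \<phi> x = \<phi> 1 + (\<Sum>k. (\<phi> (1 - q ^ k) - \<phi> 1) * l k x)"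
    if x: "x \<in> {0..1}" for x
  proof (cases "x = 1")
    case True
    \<comment> \<open>Here all limit weights vanish: the whole mass has escaped, and only the atom at 1 is left.\<close>
    then have "u x = 1" using \<gamma> by (simp add: u_def)
    then show ?thesis
      using True by (simp add: limit_q_stancu_def l_def limit_q_polya_weight_at_1[OF q])
  next
    case False
    \<comment> \<open>Here the limit weights have total mass one, so the added and the subtracted \<open>\<phi> 1\<close> cancel.\<close>
    then have "u x < 1" using x \<gamma> by (simp add: u_def)
    then have l_sums: "(\<lambda>k. l k x) sums 1"
      unfolding l_def using u[OF x] by (intro limit_q_polya_weight_sums q v)
    have l_nonneg: "0 \<le> l k x" for k
      unfolding l_def limit_q_polya_weight_def
      using q v u[OF x] \<open>u x < 1\<close>
      by (auto intro!: divide_nonneg_nonneg mult_nonneg_nonneg polya_prod_nonneg less_imp_le[OF q_pochhammer_inf_pos]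
          q_pochhammer_nonneg)
    obtain B where B: "\<And>y. y \<in> {0..1} \<Longrightarrow> \<bar>\<phi> y\<bar> \<le> B"
      using compact_imp_bounded[OF compact_continuous_image[OF assms(4)]]
      unfolding bounded_iff real_norm_def by blast
    have "summable (\<lambda>k. \<phi> (1 - q ^ k) * l k x)"
    proof (rule summable_comparison_test'[of "\<lambda>k. B * l k x" 0])
      show "summable (\<lambda>k. B * l k x)"
        using l_sums by (intro summable_mult) (simp add: sums_iff)
      show "norm (\<phi> (1 - q ^ k) * l k x) \<le> B * l k x" for k
        using B[of "1 - q ^ k"] q l_nonneg[of k]
        by (simp add: abs_mult power_le_one mult_right_mono)
    qed
    then have "(\<lambda>k. \<phi> (1 - q ^ k) * l k x - \<phi> 1 * l k x) sums ((\<Sum>k. \<phi> (1 - q ^ k) * l k x) - \<phi> 1 * 1)"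
      by (intro sums_diff sums_mult l_sums summable_sums)
    then have "(\<Sum>k. (\<phi> (1 - q ^ k) - \<phi> 1) * l k x) = (\<Sum>k. \<phi> (1 - q ^ k) * l k x) - \<phi> 1"
      by (simp add: sums_iff left_diff_distrib)
    moreover have "l k x = limit_q_stancu_basis q \<alpha> k x" for k
      using assms x
      by (simp add: l_def u_def v_def \<gamma>_def limit_q_stancu_basis_eq_limit_q_polya_weight)
    ultimately show ?thesis
      using False by (simp add: limit_q_stancu_def)
  qed
  show ?thesis
    using lim by (subst uniform_limit_cong'[OF prelimit_eq limit_eq])
qed

end
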